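(* Let $n\geq 0$ and let $L_{n+3}=L_{3,n}$ be the lariat graph. Expand $X_{L_{n+3}}$ and $X_{P_{n+3}}$ in the basis $\{e_\lambda\}$ of elementary symmetric functions. Then: (1) If $e_\lambda$ appears in $X_{L_{n+3}}$ with nonzero coefficient, then $e_\lambda$ appears in $X_{P_{n+3}}$ with nonzero coefficient. (2) If $\lambda$ is a partition with no part equal to $2$ and $e_\lambda$ appears in $X_{P_{n+3}}$ with coefficient $c_\lambda$, then $e_\lambda$ appears in $X_{L_{n+3}}$ with coefficient $2c_\lambda$. (3) The coefficient of $e_{(n+1,2)}$ in $X_{L_{n+3}}$ is $4n$. (4) The coefficient of $e_{(n,2,1)}$ in $X_{L_{n+3}}$ is $2(n-1)$. (5) The coefficient of $e_{(n-1,2,2)}$ in $X_{L_{n+3}}$ is $4(n-2)$.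
   Context: All graphs are finite and simple. For a graph $G$ with vertex set $\{v_1,\dots,v_N\}$, the chromatic symmetric function is $X_G=\sum_\kappa x_{\kappa(v_1)}\cdots x_{\kappa(v_N)}$, summed over all proper colourings $\kappa:V\to\{1,2,\dots\}$. $K_m$ is the complete graph on $m$ vertices, $P_n$ the path on $n$ vertices. For $m,n\geq1$ the lollipop graph $L_{m,n}$ is obtained from the disjoint union of $K_m$ and $P_n$ by adding an edge joining a vertex of $K_m$ to an end vertex of $P_n$, and $L_{m,0}=K_m$. The lariat graph is $L_{n+3}:=L_{3,n}$ for $n\geq0$ (a triangle with a path of $n$ vertices attached). For a partition $\lambda=(\lambda_1,\dots,\lambda_\ell)$, $e_\lambda=e_{\lambda_1}\cdots e_{\lambda_\ell}$ with $e_i$ the $i$-th elementary symmetric function; the $e_\lambda$ form a basis of the symmetric functions. A partition written with a part that is not positive (as in items (3)–(5) for small $n$) is understood with its nonpositive parts removed/coefficient interpreted accordingly.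
   Formalization: Items (3), (4), (5) are false as printed for n=1, n=2, n=3 respectively (the first part equals 2; the coefficient is 0), and these values are excluded there. Where the formula is negative (n=0 in (4); n=0,1 in (5)) the coefficient is stated to be 0. *)

theory Defs
  imports Complex_Main "HOL-Library.Poly_Mapping" "HOL-Library.Multiset" "HOL-Library.FuncSet"
begin

section \<open>Formal power series in the variables $x_0, x_1, x_2, \ldots$\<close>

text \<open>The exponent vector \<^typ>\<open>nat \<Rightarrow>\<^sub>0 nat\<close> stands for a monomial; a series is its family of
  coefficients. Symmetric functions only use the variables with positive index.\<close>

typedef 'a mseries = "UNIV :: ((nat \<Rightarrow>\<^sub>0 nat) \<Rightarrow> 'a) set"
  morphisms mcoeff Abs_mseries ..

setup_lifting type_definition_mseries

lemma mseries_eqI: "(\<And>m. mcoeff f m = mcoeff g m) \<Longrightarrow> f = g"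
  by transfer blast

definition splittings :: "(nat \<Rightarrow>\<^sub>0 nat) \<Rightarrow> ((nat \<Rightarrow>\<^sub>0 nat) \<times> (nat \<Rightarrow>\<^sub>0 nat)) set" where
  "splittings m = {(a, b). a + b = m}"

lemma finite_splittings: "finite (splittings m)"
proof -
  let ?D = "PiE (Poly_Mapping.keys m) (\<lambda>i. {..Poly_Mapping.lookup m i})"
  let ?r = "\<lambda>(a, b :: nat \<Rightarrow>\<^sub>0 nat). restrict (Poly_Mapping.lookup a) (Poly_Mapping.keys m)"
  have "inj_on ?r (splittings m)"
  proof (rule inj_onI)
    fix p q :: "(nat \<Rightarrow>\<^sub>0 nat) \<times> (nat \<Rightarrow>\<^sub>0 nat)"
    assume "p \<in> splittings m" "q \<in> splittings m" and r: "?r p = ?r q"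
    then obtain a b a' b' where pq: "p = (a, b)" "q = (a', b')"
      and m: "a + b = m" "a' + b' = m"
      by (auto simp: splittings_def)
    have eq: "restrict (Poly_Mapping.lookup a) (Poly_Mapping.keys m)
            = restrict (Poly_Mapping.lookup a') (Poly_Mapping.keys m)"
      using r pq by simp
    have "Poly_Mapping.lookup a i = Poly_Mapping.lookup a' i" for i
    proof (cases "i \<in> Poly_Mapping.keys m")
      case True
      then show ?thesis using eq by (metis restrict_apply')
    next
      case False
      then have "Poly_Mapping.lookup a i + Poly_Mapping.lookup b i = 0"
        "Poly_Mapping.lookup a' i + Poly_Mapping.lookup b' i = 0"
        using m by (metis in_keys_iff lookup_add)+
      then show ?thesis by simp
    qed
    then have "a = a'" by (simp add: poly_mapping_eqI)
    then show "p = q" using m pq by auto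
  qed
  moreover have "?r ` splittings m \<subseteq> ?D"
    by (auto simp: splittings_def lookup_add)
  moreover have "finite ?D" by (rule finite_PiE) auto
  ultimately show ?thesis by (metis finite_imageD finite_subset)
qed

instantiation mseries :: (comm_ring_1) comm_ring_1
begin

lift_definition zero_mseries :: "'a mseries" is "\<lambda>_. 0" .
lift_definition one_mseries :: "'a mseries" is "\<lambda>m. if m = 0 then 1 else 0" .
lift_definition plus_mseries :: "'a mseries \<Rightarrow> 'a mseries \<Rightarrow> 'a mseries" is "\<lambda>f g m. f m + g m" .
lift_definition minus_mseries :: "'a mseries \<Rightarrow> 'a mseries \<Rightarrow> 'a mseries" is "\<lambda>f g m. f m - g m" .
lift_definition uminus_mseries :: "'a mseries \<Rightarrow> 'a mseries" is "\<lambda>f m. - f m" .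
lift_definition times_mseries :: "'a mseries \<Rightarrow> 'a mseries \<Rightarrow> 'a mseries"
  is "\<lambda>f g m. \<Sum>(a, b)\<in>splittings m. f a * g b" .

instance
proof
  fix f g h :: "'a mseries"
  show "f + g + h = f + (g + h)" "f + g = g + f" "0 + f = f" "- f + f = 0" "f - g = f + - g"
    by (transfer; simp add: fun_eq_iff algebra_simps)+
  show "(0 :: 'a mseries) \<noteq> 1"
    by transfer (metis zero_neq_one)
  show "f * g = g * f"
  proof (transfer, rule ext)
    fix f g :: "(nat \<Rightarrow>\<^sub>0 nat) \<Rightarrow> 'a" and m
    show "(\<Sum>(a, b)\<in>splittings m. f a * g b) = (\<Sum>(a, b)\<in>splittings m. g a * f b)"
      by (rule sum.reindex_bij_witness[of _ prod.swap prod.swap])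
         (auto simp: splittings_def algebra_simps)
  qed
  show "1 * f = f"
  proof (transfer, rule ext)
    fix f :: "(nat \<Rightarrow>\<^sub>0 nat) \<Rightarrow> 'a" and m
    have "(\<Sum>(a, b)\<in>splittings m. (if a = 0 then 1 else 0) * f b)
        = (\<Sum>(a, b)\<in>{(0 :: nat \<Rightarrow>\<^sub>0 nat, m)}. (if a = 0 then 1 else 0) * f b)"
      by (rule sum.mono_neutral_right[OF finite_splittings]) (auto simp: splittings_def split: if_splits)
    then show "(\<Sum>(a, b)\<in>splittings m. (if a = 0 then 1 else 0) * f b) = f m" by simp
  qed
  show "(f + g) * h = f * h + g * h"
    by transfer (simp add: fun_eq_iff algebra_simps sum.distrib split_def)
  show "f * g * h = f * (g * h)"
  proof (transfer, rule ext)
    fix f g h :: "(nat \<Rightarrow>\<^sub>0 nat) \<Rightarrow> 'a" and m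
    have "(\<Sum>(d, c)\<in>splittings m. (\<Sum>(a, b)\<in>splittings d. f a * g b) * h c)
        = (\<Sum>p\<in>splittings m. \<Sum>q\<in>splittings (fst p). f (fst q) * g (snd q) * h (snd p))"
      by (simp add: split_def sum_distrib_right)
    also have "\<dots> = (\<Sum>(p, q)\<in>Sigma (splittings m) (\<lambda>p. splittings (fst p)).
                        f (fst q) * g (snd q) * h (snd p))"
      by (rule sum.Sigma) (auto simp: finite_splittings)
    also have "\<dots> = (\<Sum>(p, q)\<in>Sigma (splittings m) (\<lambda>p. splittings (snd p)).
                        f (fst p) * (g (fst q) * h (snd q)))"
      by (rule sum.reindex_bij_witness[of _
            "\<lambda>((a, d), (b, c)). ((a + b, c), (a, b))" "\<lambda>((d, c), (a, b)). ((a, b + c), (b, c))"])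
         (auto simp: splittings_def algebra_simps)
    also have "\<dots> = (\<Sum>p\<in>splittings m. \<Sum>q\<in>splittings (snd p).
                        f (fst p) * (g (fst q) * h (snd q)))"
      by (rule sum.Sigma[symmetric]) (auto simp: finite_splittings)
    also have "\<dots> = (\<Sum>(a, d)\<in>splittings m. f a * (\<Sum>(b, c)\<in>splittings d. g b * h c))"
      by (simp add: split_def sum_distrib_left)
    finally show "(\<Sum>(d, c)\<in>splittings m. (\<Sum>(a, b)\<in>splittings d. f a * g b) * h c)
        = (\<Sum>(a, d)\<in>splittings m. f a * (\<Sum>(b, c)\<in>splittings d. g b * h c))" .
  qed
qed

end

lift_definition mscale :: "rat \<Rightarrow> rat mseries \<Rightarrow> rat mseries" is "\<lambda>c f m. c * f m" .

global_interpretation mseries: vector_space mscale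
  defines mseries_representation = mseries.representation
  by standard (transfer; simp add: fun_eq_iff algebra_simps)+


section \<open>Elementary symmetric functions\<close>

definition squarefree_monomial :: "nat set \<Rightarrow> (nat \<Rightarrow>\<^sub>0 nat)" where
  "squarefree_monomial S = (\<Sum>i\<in>S. Poly_Mapping.single i 1)"

lift_definition elem_sym :: "nat \<Rightarrow> rat mseries"
  is "\<lambda>k m. if \<exists>S\<subseteq>{1..}. finite S \<and> card S = k \<and> m = squarefree_monomial S then 1 else 0" .

text \<open>A partition is the multiset of its parts.\<close>

definition partitions :: "nat multiset set" where
  "partitions = {la. 0 \<notin># la}"

text \<open>The notation $(a_1, \ldots, a_l)$ for a partition, with nonpositive entries dropped.\<close>

definition partition_of :: "int list \<Rightarrow> nat multiset" where
  "partition_of as = mset (map nat (filter (\<lambda>a. a > 0) as))"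

definition elem_sym_part :: "nat multiset \<Rightarrow> rat mseries" where
  "elem_sym_part la = (\<Prod>k\<in>#la. elem_sym k)"

text \<open>The coefficient of $e_\lambda$ in the expansion of \<open>f\<close> in the basis of all $e_\mu$. The library's
  representation function is \<open>0\<close> throughout if the family fails to be independent or does
  not span \<open>f\<close>.\<close>

definition e_coeff :: "rat mseries \<Rightarrow> nat multiset \<Rightarrow> rat" where
  "e_coeff f la = mseries_representation (elem_sym_part ` partitions) f (elem_sym_part la)"


section \<open>Graphs and the chromatic symmetric function\<close>

text \<open>A finite simple graph is a finite vertex set together with a set of two-element subsets of it.\<close>

type_synonym 'a graph = "'a set \<times> 'a set set"

definition proper_colourings :: "'a graph \<Rightarrow> ('a \<Rightarrow> nat) set" where
  "proper_colourings G =
     {\<kappa> \<in> fst G \<rightarrow>\<^sub>E {1..}. \<forall>u v. {u, v} \<in> snd G \<longrightarrow> \<kappa> u \<noteq> \<kappa> v}"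

definition colouring_monomial :: "'a graph \<Rightarrow> ('a \<Rightarrow> nat) \<Rightarrow> (nat \<Rightarrow>\<^sub>0 nat)" where
  "colouring_monomial G \<kappa> = (\<Sum>v\<in>fst G. Poly_Mapping.single (\<kappa> v) 1)"

text \<open>The formal sum over the infinitely many proper colourings: the coefficient of a monomial
  counts the (finitely many) proper colourings that contribute it.\<close>

lift_definition chromatic_sym :: "'a graph \<Rightarrow> rat mseries"
  is "\<lambda>G m. of_nat (card {\<kappa> \<in> proper_colourings G. colouring_monomial G \<kappa> = m})" .

definition complete_graph :: "nat \<Rightarrow> nat graph" where
  "complete_graph m = ({1..m}, {{i, j} | i j. i \<in> {1..m} \<and> j \<in> {1..m} \<and> i \<noteq> j})"

definition path_graph :: "nat \<Rightarrow> nat graph" where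
  "path_graph n = ({1..n}, {{i, i + 1} | i. 1 \<le> i \<and> i < n})"

definition disjoint_union :: "'a graph \<Rightarrow> 'b graph \<Rightarrow> ('a + 'b) graph" where
  "disjoint_union G H = (fst G <+> fst H, image Inl ` snd G \<union> image Inr ` snd H)"

text \<open>For \<open>n = 0\<close> this is the complete graph, up to the relabelling by \<^const>\<open>Inl\<close>.\<close>

definition lollipop :: "nat \<Rightarrow> nat \<Rightarrow> (nat + nat) graph" where
  "lollipop m n =
     (let G = disjoint_union (complete_graph m) (path_graph n)
      in (fst G, snd G \<union> (if n = 0 then {} else {{Inl 1, Inr 1}})))"

text \<open>The lariat graph on \<open>n + 3\<close> vertices.\<close>

definition lariat :: "nat \<Rightarrow> (nat + nat) graph" where
  "lariat n = lollipop 3 n"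

end

theory Submission
  imports Defs "HOL-Library.Disjoint_Sets"
begin

text \<open>
  Colourings are read as words, so that \<open>X\<close> of the path on \<open>n\<close> vertices is the generating function
  of words of length \<open>n\<close> without equal neighbours. Moving a marked element of a set in front of such
  a word, if that creates no equal neighbours, gives
  \<open>X\<^sub>P\<^sub>n = e\<^sub>n + (\<Sum>k. (k - 1) e\<^sub>k X\<^sub>P\<^sub>n\<^sub>-\<^sub>k)\<close>, so the coefficients of paths are nonnegative and
  computable by removing parts. Triple deletion at the triangle gives
  \<open>X\<^sub>L = 2 X\<^sub>P - 2 e\<^sub>2 X\<^sub>P'\<close>, where \<open>P'\<close> has two vertices fewer. The correction only affects
  partitions with a part 2, where it cancels against the term \<open>k = 2\<close> of the recurrence.
  The coefficients are well defined because the \<open>e\<^sub>\<lambda>\<close> have distinct leading monomials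
  (given by the conjugate partitions) in the lexicographic order.
\<close>

section \<open>Independence of the elementary symmetric functions\<close>

lemma lookup_squarefree_monomial:
  "finite S \<Longrightarrow> Poly_Mapping.lookup (squarefree_monomial S) i = (if i \<in> S then 1 else 0)"
  unfolding squarefree_monomial_def
  by (simp add: lookup_sum lookup_single when_def)

lemma squarefree_monomial_inj:
  assumes "finite S" "finite T" "squarefree_monomial S = squarefree_monomial T"
  shows "S = T"
proof (rule set_eqI)
  fix i
  show "i \<in> S \<longleftrightarrow> i \<in> T"
    using arg_cong[OF assms(3), of "\<lambda>m. Poly_Mapping.lookup m i"]
    by (simp add: lookup_squarefree_monomial assms(1,2) split: if_splits)
qed

text \<open>As \<open>S\<close> has \<open>k\<close> elements, either it is \<open>{1..k}\<close> or
  some least \<open>j\<close> in \<open>{1..k}\<close> is missing from it. There the exponents are 0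
  and 1, below \<open>j\<close> they agree, and this decides the lexicographic order.\<close>

lemma squarefree_monomial_le:
  assumes "S \<subseteq> {1..}" "finite S" "card S = k"
  shows "squarefree_monomial S \<le> squarefree_monomial {1..k}"
proof (cases "S = {1..k}")
  case False
  have "\<not> {1..k} \<subseteq> S"
    using False card_subset_eq[OF assms(2), of "{1..k}"] assms(3) by auto
  then have ex: "\<exists>j. j \<in> {1..k} \<and> j \<notin> S" by blast
  define j where "j = (LEAST j. j \<in> {1..k} \<and> j \<notin> S)"
  have j: "j \<in> {1..k}" "j \<notin> S"
    using LeastI_ex[OF ex] unfolding j_def by auto
  have below: "i \<in> S" if "i < j" "1 \<le> i" for i
    using not_less_Least[of i "\<lambda>j. j \<in> {1..k} \<and> j \<notin> S"] that j unfolding j_def by auto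
  have "less_fun (Poly_Mapping.lookup (squarefree_monomial S))
      (Poly_Mapping.lookup (squarefree_monomial {1..k}))"
    unfolding less_fun_def
  proof (intro exI[of _ j] conjI allI impI)
    show "Poly_Mapping.lookup (squarefree_monomial S) j
        < Poly_Mapping.lookup (squarefree_monomial {1..k}) j"
      using j assms by (simp add: lookup_squarefree_monomial)
    fix i assume "i < j"
    then show "Poly_Mapping.lookup (squarefree_monomial S) i
        = Poly_Mapping.lookup (squarefree_monomial {1..k}) i"
      using j below[of i] assms by (auto simp: lookup_squarefree_monomial)
  qed
  then show ?thesis by (simp add: less_eq_poly_mapping.rep_eq)
qed simp

text \<open>Monomials are compared lexicographically, the variable of least index being most
  significant.\<close>

definition monic_at :: "(nat \<Rightarrow>\<^sub>0 nat) \<Rightarrow> rat mseries \<Rightarrow> bool" where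
  "monic_at m f \<longleftrightarrow> mcoeff f m = 1 \<and> (\<forall>m'. mcoeff f m' \<noteq> 0 \<longrightarrow> m' \<le> m)"

lemma monic_at_one: "monic_at 0 1"
  by (simp add: monic_at_def one_mseries.rep_eq)

text \<open>Addition is strictly monotone for the order, so \<open>m + l\<close> splits into
  contributing monomials only as \<open>m\<close> and \<open>l\<close>.\<close>

lemma monic_at_mult:
  assumes f: "monic_at m f" and g: "monic_at l g"
  shows "monic_at (m + l) (f * g)"
proof -
  have le: "a + b \<le> m + l" if "mcoeff f a * mcoeff g b \<noteq> 0" for a b
    using that f g by (auto simp: monic_at_def intro: add_mono)
  have eq: "a = m \<and> b = l" if nz: "mcoeff f a * mcoeff g b \<noteq> 0" and s: "a + b = m + l" for a b
  proof -
    have a: "a \<le> m" and b: "b \<le> l" using nz f g by (auto simp: monic_at_def)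
    have "m + b \<le> m + l" by (rule add_left_mono[OF b])
    moreover have "a + b \<le> m + b" by (rule add_right_mono[OF a])
    ultimately have "a + b = m + b" using s by simp
    then show ?thesis using s by simp
  qed
  have "mcoeff (f * g) (m + l) = (\<Sum>(a, b)\<in>splittings (m + l). mcoeff f a * mcoeff g b)"
    by (simp add: times_mseries.rep_eq)
  also have "\<dots> = (\<Sum>(a, b)\<in>{(m, l)}. mcoeff f a * mcoeff g b)"
    using eq by (intro sum.mono_neutral_right[OF finite_splittings]) (auto simp: splittings_def)
  also have "\<dots> = 1" using f g by (simp add: monic_at_def)
  finally have "mcoeff (f * g) (m + l) = 1" .
  moreover have "m' \<le> m + l" if "mcoeff (f * g) m' \<noteq> 0" for m'
  proof -
    have "(\<Sum>p\<in>splittings m'. mcoeff f (fst p) * mcoeff g (snd p)) \<noteq> 0"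
      using that by (simp add: times_mseries.rep_eq split_def)
    then obtain p where "p \<in> splittings m'" "mcoeff f (fst p) * mcoeff g (snd p) \<noteq> 0"
      by (meson sum.neutral)
    then show ?thesis using le[of "fst p" "snd p"] by (auto simp: splittings_def)
  qed
  ultimately show ?thesis by (simp add: monic_at_def)
qed

text \<open>Triangularity: in a vanishing combination, the coefficient at the largest leading
  monomial among the vectors that occur comes from a single vector.\<close>

lemma independent_monic_at:
  assumes l: "\<And>v. v \<in> B \<Longrightarrow> monic_at (l v) v" and inj: "inj_on l B"
  shows "mseries.independent B"
  unfolding mseries.independent_explicit_finite_subsets
proof (intro allI impI ballI)
  fix S u v
  assume S: "S \<subseteq> B" "finite S" and sum0: "(\<Sum>v\<in>S. mscale (u v) v) = 0" and v: "v \<in> S"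
  show "u v = 0"
  proof (rule ccontr)
    assume "u v \<noteq> 0"
    define T where "T = {v \<in> S. u v \<noteq> 0}"
    have T: "finite T" "T \<noteq> {}" "T \<subseteq> B" using S v \<open>u v \<noteq> 0\<close> by (auto simp: T_def)
    have "Max (l ` T) \<in> l ` T" using T by (intro Max_in) auto
    then obtain w where w: "w \<in> T" "Max (l ` T) = l w" by blast
    have maxw: "l x \<le> l w" if "x \<in> T" for x using T that w(2) by (metis Max_ge finite_imageI imageI)
    have "mcoeff (\<Sum>v\<in>S. mscale (u v) v) m = (\<Sum>v\<in>S. u v * mcoeff v m)" for m
      using S(2) by (induction S) (auto simp: zero_mseries.rep_eq plus_mseries.rep_eq mscale.rep_eq)
    then have "0 = (\<Sum>v\<in>S. u v * mcoeff v (l w))"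
      using sum0 by (metis zero_mseries.rep_eq)
    also have "\<dots> = (\<Sum>v\<in>{w}. u v * mcoeff v (l w))"
    proof (rule sum.mono_neutral_right[OF S(2)])
      show "{w} \<subseteq> S" using w by (auto simp: T_def)
      show "\<forall>x\<in>S - {w}. u x * mcoeff x (l w) = 0"
      proof (intro ballI, rule ccontr)
        fix x assume x: "x \<in> S - {w}" "u x * mcoeff x (l w) \<noteq> 0"
        then have xT: "x \<in> T" by (auto simp: T_def)
        then have "l w \<le> l x" using l[of x] T x by (auto simp: monic_at_def)
        then have "l x = l w" using maxw[OF xT] by simp
        then show False using inj T xT w x by (auto dest: inj_onD)
      qed
    qed
    also have "\<dots> = u w" using l[of w] w T by (auto simp: monic_at_def)
    finally show False using w by (simp add: T_def)
  qed
qed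

text \<open>The exponent of the variable \<open>j \<ge> 1\<close> is the number of parts of size at
  least \<open>j\<close>, that is, part \<open>j\<close> of the conjugate partition.\<close>

definition conjugate_monomial :: "nat multiset \<Rightarrow> (nat \<Rightarrow>\<^sub>0 nat)" where
  "conjugate_monomial la = (\<Sum>k\<in>#la. squarefree_monomial {1..k})"

lemma monic_at_elem_sym: "monic_at (squarefree_monomial {1..k}) (elem_sym k)"
  using squarefree_monomial_le[of _ k] by (auto simp: monic_at_def elem_sym.rep_eq intro!: exI[of _ "{1..k}"])

lemma monic_at_elem_sym_part: "monic_at (conjugate_monomial la) (elem_sym_part la)"
proof (induction la)
  case empty
  show ?case by (simp add: elem_sym_part_def conjugate_monomial_def monic_at_one)
next
  case (add k la)
  from monic_at_mult[OF monic_at_elem_sym[of k] add] show ?case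
    by (simp add: elem_sym_part_def conjugate_monomial_def)
qed

lemma lookup_conjugate_monomial:
  "Poly_Mapping.lookup (conjugate_monomial la) j = (if j = 0 then 0 else size {#k \<in># la. j \<le> k#})"
  by (induction la) (auto simp: conjugate_monomial_def lookup_add lookup_squarefree_monomial)

text \<open>The multiplicity of \<open>j \<ge> 1\<close> is the number of parts at least
  \<open>j\<close> minus that of parts at least \<open>Suc j\<close>. A part 0 would leave no trace
  in the monomial; membership in \<open>partitions\<close> rules it out.\<close>

lemma inj_on_conjugate_monomial: "inj_on conjugate_monomial partitions"
proof (rule inj_onI)
  fix la mu assume p: "la \<in> partitions" "mu \<in> partitions"
    and eq: "conjugate_monomial la = conjugate_monomial mu"
  have size_eq: "size {#k \<in># la. j \<le> k#} = size {#k \<in># mu. j \<le> k#}" if "j \<noteq> 0" for j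
    using lookup_conjugate_monomial[of la j] lookup_conjugate_monomial[of mu j] eq that by simp
  have count: "size {#k \<in># nu. j \<le> k#} = size {#k \<in># nu. Suc j \<le> k#} + count nu j"
    for nu :: "nat multiset" and j
    by (induction nu) auto
  show "la = mu"
  proof (rule multiset_eqI)
    fix j
    show "count la j = count mu j"
    proof (cases "j = 0")
      case True
      then show ?thesis using p by (simp add: partitions_def not_in_iff)
    next
      case False
      then show ?thesis using count[of j la] count[of j mu] size_eq[of j] size_eq[of "Suc j"] by simp
    qed
  qed
qed

lemma monic_at_unique: "monic_at m f \<Longrightarrow> monic_at l f \<Longrightarrow> m = l"
  by (auto simp: monic_at_def intro!: antisym)

text \<open>\<open>e_coeff\<close> refers to the image of \<open>partitions\<close>, so different
  partitions must not share a basis vector.\<close>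

lemma inj_on_elem_sym_part: "inj_on elem_sym_part partitions"
proof (rule inj_onI)
  fix la mu assume p: "la \<in> partitions" "mu \<in> partitions" and "elem_sym_part la = elem_sym_part mu"
  then have "conjugate_monomial la = conjugate_monomial mu"
    using monic_at_elem_sym_part[of la] monic_at_elem_sym_part[of mu] by (simp add: monic_at_unique)
  then show "la = mu" using inj_onD[OF inj_on_conjugate_monomial] p by blast
qed

lemma independent_elem_sym_part: "mseries.independent (elem_sym_part ` partitions)"
proof (rule independent_monic_at)
  \<comment> \<open>The leading monomial has to be a function of the series, so the partition is
    first recovered from it.\<close>
  let ?l = "\<lambda>v. conjugate_monomial (the_inv_into partitions elem_sym_part v)"
  show "monic_at (?l v) v" if "v \<in> elem_sym_part ` partitions" for v
    using that monic_at_elem_sym_part by (auto simp: the_inv_into_f_f[OF inj_on_elem_sym_part])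
  show "inj_on ?l (elem_sym_part ` partitions)"
    using inj_on_conjugate_monomial
    by (auto simp: inj_on_def the_inv_into_f_f[OF inj_on_elem_sym_part])
qed

section \<open>Coefficients in the elementary basis\<close>

abbreviation e_span :: "rat mseries set" where
  "e_span \<equiv> mseries.span (elem_sym_part ` partitions)"

lemma e_coeff_add: "f \<in> e_span \<Longrightarrow> g \<in> e_span \<Longrightarrow> e_coeff (f + g) la = e_coeff f la + e_coeff g la"
  unfolding e_coeff_def
  using mseries.representation_add[OF independent_elem_sym_part] by simp

lemma e_coeff_diff: "f \<in> e_span \<Longrightarrow> g \<in> e_span \<Longrightarrow> e_coeff (f - g) la = e_coeff f la - e_coeff g la"
  unfolding e_coeff_def
  using mseries.representation_diff[OF independent_elem_sym_part] by simp

lemma e_coeff_scale: "f \<in> e_span \<Longrightarrow> e_coeff (mscale c f) la = c * e_coeff f la"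
  unfolding e_coeff_def
  using mseries.representation_scale[OF independent_elem_sym_part] by simp

lemma e_coeff_zero: "e_coeff 0 la = 0"
  unfolding e_coeff_def by (simp add: mseries.representation_zero)

lemma e_coeff_sum:
  "finite I \<Longrightarrow> (\<And>i. i \<in> I \<Longrightarrow> f i \<in> e_span) \<Longrightarrow> e_coeff (\<Sum>i\<in>I. f i) la = (\<Sum>i\<in>I. e_coeff (f i) la)"
  by (induction I rule: finite_induct) (simp_all add: e_coeff_zero e_coeff_add mseries.span_sum)

lemma elem_sym_part_in_span: "la \<in> partitions \<Longrightarrow> elem_sym_part la \<in> e_span"
  by (simp add: mseries.span_base)

lemma e_coeff_elem_sym_part:
  "la \<in> partitions \<Longrightarrow> mu \<in> partitions \<Longrightarrow> e_coeff (elem_sym_part mu) la = (if la = mu then 1 else 0)"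
  unfolding e_coeff_def
  using mseries.representation_basis[OF independent_elem_sym_part, of "elem_sym_part mu"]
    inj_on_eq_iff[OF inj_on_elem_sym_part] by simp

lemma mscale_eq_times: "mscale c f = mscale c 1 * f"
proof (rule mseries_eqI)
  fix m
  have "(\<Sum>(a, b)\<in>splittings m. mcoeff (mscale c 1) a * mcoeff f b)
      = (\<Sum>(a, b)\<in>{(0, m)}. mcoeff (mscale c 1) a * mcoeff f b)"
    by (rule sum.mono_neutral_right[OF finite_splittings])
       (auto simp: splittings_def mscale.rep_eq one_mseries.rep_eq split: if_splits)
  then show "mcoeff (mscale c f) m = mcoeff (mscale c 1 * f) m"
    by (simp add: times_mseries.rep_eq mscale.rep_eq one_mseries.rep_eq)
qed

lemma times_mscale: "f * mscale c g = mscale c (f * g)"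
  by (metis mscale_eq_times mult.left_commute)

text \<open>Turns the integer factors of the recurrences into scalars, to which the rules for spans
  and \<open>e_coeff\<close> apply.\<close>

lemma mscale_of_nat: "mscale (of_nat k) f = of_nat k * f"
proof (induction k)
  case 0
  then show ?case by (simp add: mseries.scale_zero_left)
next
  case (Suc k)
  then show ?case by (simp add: mseries.scale_left_distrib algebra_simps)
qed

text \<open>On basis vectors, multiplication by \<open>elem_sym k\<close> sends \<open>mu\<close> to
  \<open>add_mset k mu\<close>; the rest is linearity. \<open>k \<ge> 1\<close> keeps the result a
  partition.\<close>

lemma elem_sym_times:
  assumes k: "k \<ge> 1" and f: "f \<in> e_span"
  shows elem_sym_times_in_span: "elem_sym k * f \<in> e_span"
    and e_coeff_elem_sym_times: "la \<in> partitions \<Longrightarrow>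
      e_coeff (elem_sym k * f) la = (if k \<in># la then e_coeff f (la - {#k#}) else 0)"
proof -
  \<comment> \<open>Membership of \<open>f\<close> is part of the invariant because
    \<open>e_coeff\<close> is additive only on the span.\<close>
  have "f \<in> e_span \<and> elem_sym k * f \<in> e_span \<and> (\<forall>la \<in> partitions.
      e_coeff (elem_sym k * f) la = (if k \<in># la then e_coeff f (la - {#k#}) else 0))"
    using f
  proof (induction rule: mseries.span_induct_alt)
    case base
    then show ?case by (simp add: mseries.span_zero e_coeff_zero)
  next
    case (step c x y)
    then obtain mu where mu: "mu \<in> partitions" "x = elem_sym_part mu" by blast
    let ?nu = "add_mset k mu"
    have nu: "?nu \<in> partitions" using mu k by (simp add: partitions_def)
    have "elem_sym k * x = elem_sym_part ?nu" by (simp add: mu elem_sym_part_def)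
    then have eq: "elem_sym k * (mscale c x + y) = mscale c (elem_sym_part ?nu) + elem_sym k * y"
      by (simp add: distrib_left times_mscale)
    note span = elem_sym_part_in_span[OF nu] elem_sym_part_in_span[OF mu(1)]
    have "e_coeff (elem_sym k * (mscale c x + y)) la
        = (if k \<in># la then e_coeff (mscale c x + y) (la - {#k#}) else 0)"
      if la: "la \<in> partitions" for la
    proof -
      have "la - {#k#} \<in> partitions" using la by (auto simp: partitions_def dest: in_diffD)
      moreover have "la = ?nu \<longleftrightarrow> k \<in># la \<and> la - {#k#} = mu" by auto
      ultimately show ?thesis
        using step la mu span nu unfolding eq
        by (auto simp: e_coeff_add e_coeff_scale mseries.span_scale e_coeff_elem_sym_part)
    qed
    then show ?case using step span eq mu by (auto intro: mseries.span_add mseries.span_scale)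
  qed
  then show "elem_sym k * f \<in> e_span" "la \<in> partitions \<Longrightarrow>
      e_coeff (elem_sym k * f) la = (if k \<in># la then e_coeff f (la - {#k#}) else 0)" by auto
qed

section \<open>Generating functions of weighted families\<close>

definition weight_gf :: "'b set \<Rightarrow> ('b \<Rightarrow> (nat \<Rightarrow>\<^sub>0 nat)) \<Rightarrow> rat mseries" where
  "weight_gf A w = Abs_mseries (\<lambda>m. of_nat (card {a \<in> A. w a = m}))"

lemma mcoeff_weight_gf: "mcoeff (weight_gf A w) m = of_nat (card {a \<in> A. w a = m})"
  by (simp add: weight_gf_def Abs_mseries_inverse)

text \<open>\<open>card\<close> is 0 on infinite sets, so finite fibres are what makes
  \<open>weight_gf\<close> additive over disjoint unions and multiplicative over products.\<close>

definition finite_fibres :: "'b set \<Rightarrow> ('b \<Rightarrow> (nat \<Rightarrow>\<^sub>0 nat)) \<Rightarrow> bool" where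
  "finite_fibres A w \<longleftrightarrow> (\<forall>m. finite {a \<in> A. w a = m})"

lemma finite_fibres_subset: "finite_fibres B w \<Longrightarrow> A \<subseteq> B \<Longrightarrow> finite_fibres A w"
  unfolding finite_fibres_def
proof
  fix m assume "\<forall>m. finite {a \<in> B. w a = m}" "A \<subseteq> B"
  then show "finite {a \<in> A. w a = m}"
    by (intro finite_subset[of "{a \<in> A. w a = m}" "{a \<in> B. w a = m}"]) auto
qed

lemma weight_gf_cong_bij:
  assumes h: "bij_betw h A B" and w: "\<And>a. a \<in> A \<Longrightarrow> v (h a) = w a"
  shows "weight_gf A w = weight_gf B v"
proof (rule mseries_eqI)
  fix m
  have "bij_betw h {a \<in> A. w a = m} {b \<in> B. v b = m}"
    using h
  proof (rule bij_betw_subset)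
    have "B = h ` A" using h by (simp add: bij_betw_def)
    then show "h ` {a \<in> A. w a = m} = {b \<in> B. v b = m}" using w by auto
  qed auto
  then show "mcoeff (weight_gf A w) m = mcoeff (weight_gf B v) m"
    by (simp add: mcoeff_weight_gf bij_betw_same_card)
qed

lemma weight_gf_Un:
  assumes "finite_fibres A w" "finite_fibres B w" "A \<inter> B = {}"
  shows "weight_gf (A \<union> B) w = weight_gf A w + weight_gf B w"
proof (rule mseries_eqI)
  fix m
  have "{a \<in> A \<union> B. w a = m} = {a \<in> A. w a = m} \<union> {a \<in> B. w a = m}" by blast
  then have "card {a \<in> A \<union> B. w a = m} = card {a \<in> A. w a = m} + card {a \<in> B. w a = m}"
    using assms by (simp add: finite_fibres_def) (subst card_Un_disjoint; auto)
  then show "mcoeff (weight_gf (A \<union> B) w) m = mcoeff (weight_gf A w + weight_gf B w) m"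
    by (simp add: mcoeff_weight_gf plus_mseries.rep_eq)
qed

lemma weight_gf_empty: "weight_gf {} w = 0"
  by (rule mseries_eqI) (simp add: mcoeff_weight_gf zero_mseries.rep_eq)

lemma finite_fibres_UN:
  assumes "finite I" "\<And>i. i \<in> I \<Longrightarrow> finite_fibres (A i) w"
  shows "finite_fibres (\<Union>i\<in>I. A i) w"
proof -
  have "{a \<in> (\<Union>i\<in>I. A i). w a = m} = (\<Union>i\<in>I. {a \<in> A i. w a = m})" for m by blast
  then show ?thesis using assms by (simp add: finite_fibres_def)
qed

lemma weight_gf_UN:
  assumes "finite I" "\<And>i. i \<in> I \<Longrightarrow> finite_fibres (A i) w" "disjoint_family_on A I"
  shows "weight_gf (\<Union>i\<in>I. A i) w = (\<Sum>i\<in>I. weight_gf (A i) w)"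
  using assms
proof (induction I rule: finite_induct)
  case empty
  then show ?case by (simp add: weight_gf_empty)
next
  case (insert i I)
  have "A i \<inter> (\<Union>j\<in>I. A j) = {}"
    using insert(2,5) by (fastforce simp: disjoint_family_on_def)
  moreover have "disjoint_family_on A I" using insert(5) by (auto simp: disjoint_family_on_def)
  ultimately show ?case using insert by (simp add: weight_gf_Un finite_fibres_UN)
qed

lemma fibre_Times:
  "{p \<in> A \<times> B. (case p of (a, b) \<Rightarrow> w a + v b) = m}
     = (\<Union>(x, y)\<in>splittings m. {a \<in> A. w a = x} \<times> {b \<in> B. v b = y})"
  by (auto simp: splittings_def)

lemma finite_fibres_Times:
  "finite_fibres A w \<Longrightarrow> finite_fibres B v \<Longrightarrow> finite_fibres (A \<times> B) (\<lambda>(a, b). w a + v b)"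
  unfolding finite_fibres_def fibre_Times by (auto intro!: finite_UN_I finite_splittings)

text \<open>A fibre of the product splits, over all \<open>splittings m\<close>, into products of
  fibres; this is the Cauchy product of series.\<close>

lemma weight_gf_times:
  assumes "finite_fibres A w" "finite_fibres B v"
  shows "weight_gf A w * weight_gf B v = weight_gf (A \<times> B) (\<lambda>(a, b). w a + v b)"
proof (rule mseries_eqI)
  fix m
  have "card {p \<in> A \<times> B. (case p of (a, b) \<Rightarrow> w a + v b) = m}
      = (\<Sum>p\<in>splittings m. card ({a \<in> A. w a = fst p} \<times> {b \<in> B. v b = snd p}))"
    unfolding fibre_Times unfolding split_def
    using assms by (intro card_UN_disjoint) (auto simp: finite_splittings finite_fibres_def)
  then show "mcoeff (weight_gf A w * weight_gf B v) m
      = mcoeff (weight_gf (A \<times> B) (\<lambda>(a, b). w a + v b)) m"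
    by (simp add: mcoeff_weight_gf times_mseries.rep_eq split_def card_cartesian_product)
qed

section \<open>Elementary symmetric functions as generating functions of finite sets\<close>

definition subsets_of_card :: "nat \<Rightarrow> nat set set" where
  "subsets_of_card k = {S. S \<subseteq> {1..} \<and> finite S \<and> card S = k}"

lemma finite_fibres_subsets: "finite_fibres (subsets_of_card k) squarefree_monomial"
  unfolding finite_fibres_def
proof
  fix m
  have "{S \<in> subsets_of_card k. squarefree_monomial S = m} \<subseteq> {Poly_Mapping.keys m}"
    by (auto simp: subsets_of_card_def in_keys_iff lookup_squarefree_monomial split: if_splits)
  then show "finite {S \<in> subsets_of_card k. squarefree_monomial S = m}"
    by (rule finite_subset) simp
qed

text \<open>A finite set is determined by its squarefree monomial, so each fibre has at most one
  element, in accordance with the coefficients 0 and 1 of \<open>elem_sym k\<close>.\<close>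

lemma elem_sym_eq_weight_gf: "elem_sym k = weight_gf (subsets_of_card k) squarefree_monomial"
proof (rule mseries_eqI)
  fix m
  show "mcoeff (elem_sym k) m = mcoeff (weight_gf (subsets_of_card k) squarefree_monomial) m"
  proof (cases "\<exists>S \<in> subsets_of_card k. m = squarefree_monomial S")
    case True
    then obtain S where S: "S \<in> subsets_of_card k" "m = squarefree_monomial S" by blast
    then have "{T \<in> subsets_of_card k. squarefree_monomial T = m} = {S}"
      by (auto simp: subsets_of_card_def dest: squarefree_monomial_inj)
    then show ?thesis
      using S by (auto simp: elem_sym.rep_eq mcoeff_weight_gf subsets_of_card_def)
  next
    case False
    then have "mcoeff (elem_sym k) m = 0" by (auto simp: elem_sym.rep_eq subsets_of_card_def)
    moreover have "{T \<in> subsets_of_card k. squarefree_monomial T = m} = {}" using False by auto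
    ultimately show ?thesis by (simp only: mcoeff_weight_gf card.empty of_nat_0)
  qed
qed

section \<open>Colourings as words\<close>

definition word_monomial :: "nat list \<Rightarrow> (nat \<Rightarrow>\<^sub>0 nat)" where
  "word_monomial xs = (\<Sum>x\<leftarrow>xs. Poly_Mapping.single x 1)"

lemma word_monomial_simps [simp]:
  "word_monomial [] = 0"
  "word_monomial (x # xs) = Poly_Mapping.single x 1 + word_monomial xs"
  by (simp_all add: word_monomial_def)

lemma keys_word_monomial: "Poly_Mapping.keys (word_monomial xs) = set xs"
proof (induction xs)
  case (Cons x xs)
  have "y \<in> Poly_Mapping.keys (word_monomial (x # xs))
      \<longleftrightarrow> y = x \<or> y \<in> Poly_Mapping.keys (word_monomial xs)" for y
    by (auto simp: in_keys_iff lookup_add lookup_single when_def)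
  then show ?case using Cons by auto
qed simp

lemma finite_fibres_words: "finite_fibres {xs. length xs = n} word_monomial"
  unfolding finite_fibres_def
proof
  fix m
  have "{xs \<in> {xs. length xs = n}. word_monomial xs = m}
      \<subseteq> {xs. set xs \<subseteq> Poly_Mapping.keys m \<and> length xs = n}"
    using keys_word_monomial by auto
  then show "finite {xs \<in> {xs. length xs = n}. word_monomial xs = m}"
    by (rule finite_subset) (simp add: finite_lists_length_eq)
qed

text \<open>Colourings are extensional on the vertex set, so their values along an enumeration
  \<open>vs\<close> of the vertices determine them.\<close>

lemma chromatic_sym_eq_weight_gf:
  assumes V: "set vs = fst G" and d: "distinct vs"
  shows "chromatic_sym G = weight_gf ((\<lambda>\<kappa>. map \<kappa> vs) ` proper_colourings G) word_monomial"
proof -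
  have "chromatic_sym G = weight_gf (proper_colourings G) (colouring_monomial G)"
    by (rule mseries_eqI) (simp add: chromatic_sym.rep_eq mcoeff_weight_gf)
  also have "\<dots> = weight_gf ((\<lambda>\<kappa>. map \<kappa> vs) ` proper_colourings G) word_monomial"
  proof (rule weight_gf_cong_bij)
    have "inj_on (\<lambda>\<kappa>. map \<kappa> vs) (proper_colourings G)"
    proof (rule inj_onI)
      fix \<kappa> \<kappa>' assume "\<kappa> \<in> proper_colourings G" "\<kappa>' \<in> proper_colourings G" and "map \<kappa> vs = map \<kappa>' vs"
      then show "\<kappa> = \<kappa>'"
        using V by (intro PiE_ext[of \<kappa> "fst G" "\<lambda>_. {1..}" \<kappa>']) (auto simp: proper_colourings_def)
    qed
    then show "bij_betw (\<lambda>\<kappa>. map \<kappa> vs) (proper_colourings G) ((\<lambda>\<kappa>. map \<kappa> vs) ` proper_colourings G)"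
      by (rule inj_on_imp_bij_betw)
    show "word_monomial (map \<kappa> vs) = colouring_monomial G \<kappa>" for \<kappa> :: "'a \<Rightarrow> nat"
      using d V[symmetric]
      by (simp add: word_monomial_def colouring_monomial_def sum_list_distinct_conv_sum_set o_def)
  qed
  finally show ?thesis .
qed

definition path_words :: "nat \<Rightarrow> nat list set" where
  "path_words n = {xs. length xs = n \<and> set xs \<subseteq> {1..} \<and> distinct_adj xs}"

lemma finite_fibres_path_words: "finite_fibres (path_words n) word_monomial"
  by (rule finite_fibres_subset[OF finite_fibres_words[of n]]) (auto simp: path_words_def)

lemma edges_path_graph:
  "{u, v} \<in> snd (path_graph n) \<longleftrightarrow> (u \<ge> 1 \<and> u < n \<and> v = Suc u) \<or> (v \<ge> 1 \<and> v < n \<and> u = Suc v)"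
  by (auto simp: path_graph_def doubleton_eq_iff)

lemma path_colourings_words:
  "(\<lambda>\<kappa>. map \<kappa> [1..<Suc n]) ` proper_colourings (path_graph n) = path_words n" (is "?L = _")
proof (intro equalityI subsetI)
  fix xs assume "xs \<in> ?L"
  then obtain \<kappa> where \<kappa>: "\<kappa> \<in> proper_colourings (path_graph n)" and xs: "xs = map \<kappa> [1..<Suc n]"
    by blast
  have "xs ! i \<noteq> xs ! Suc i" if "Suc i < n" for i
  proof -
    have "{Suc i, Suc (Suc i)} \<in> snd (path_graph n)" using that by (simp add: edges_path_graph)
    then have "\<kappa> (Suc i) \<noteq> \<kappa> (Suc (Suc i))" using \<kappa> unfolding proper_colourings_def by blast
    then show ?thesis using that by (simp add: xs del: upt_Suc)
  qed
  moreover have "set xs \<subseteq> {1..}"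
    using \<kappa> by (force simp: xs proper_colourings_def path_graph_def simp del: upt_Suc)
  ultimately show "xs \<in> path_words n"
    by (auto simp: path_words_def distinct_adj_conv_nth xs simp del: upt_Suc)
next
  fix xs assume xs: "xs \<in> path_words n"
  \<comment> \<open>Vertices count from 1 and list positions from 0; \<open>restrict\<close>
    supplies the default value outside the vertex set.\<close>
  let ?\<kappa> = "restrict (\<lambda>i. xs ! (i - 1)) {1..n}"
  have "?\<kappa> \<in> fst (path_graph n) \<rightarrow>\<^sub>E {1..}"
  proof (rule PiE_I)
    fix i assume "i \<in> fst (path_graph n)"
    then have "i \<in> {1..n}" "i - 1 < length xs" using xs by (auto simp: path_words_def path_graph_def)
    moreover from this have "xs ! (i - 1) \<in> {1..}"
      using xs nth_mem[of "i - 1" xs] unfolding path_words_def by blast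
    ultimately show "?\<kappa> i \<in> {1..}" by simp
  qed (auto simp: path_graph_def restrict_def)
  moreover have step: "?\<kappa> u \<noteq> ?\<kappa> (Suc u)" if "1 \<le> u" "u < n" for u
    using xs distinct_adj_nth[of xs "u - 1"] that by (auto simp: path_words_def)
  have "?\<kappa> u \<noteq> ?\<kappa> v" if "{u, v} \<in> snd (path_graph n)" for u v
    using that unfolding edges_path_graph
  proof (elim disjE conjE)
    assume "1 \<le> u" "u < n" "v = Suc u"
    then show ?thesis using step[of u] by blast
  next
    assume "1 \<le> v" "v < n" "u = Suc v"
    then show ?thesis using step[of v] by metis
  qed
  ultimately have "?\<kappa> \<in> proper_colourings (path_graph n)"
    unfolding proper_colourings_def by blast
  moreover have "xs = map ?\<kappa> [1..<Suc n]"
    using xs by (intro nth_equalityI) (auto simp: path_words_def simp del: upt_Suc)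
  ultimately show "xs \<in> ?L" by blast
qed

lemma chromatic_sym_path: "chromatic_sym (path_graph n) = weight_gf (path_words n) word_monomial"
proof -
  have "set [1..<Suc n] = fst (path_graph n)" by (auto simp: path_graph_def)
  from chromatic_sym_eq_weight_gf[OF this distinct_upt] show ?thesis
    unfolding path_colourings_words .
qed

text \<open>\<open>a\<close> colours the vertex \<open>Inl 1\<close> that carries the path, so
  \<open>a # w\<close> colours a path on \<open>n + 1\<close> vertices. With the triangle written
  first, these words differ from path words of length \<open>n + 3\<close> only by the condition
  \<open>a \<noteq> c\<close>.\<close>

definition lariat_words :: "nat \<Rightarrow> nat list set" where
  "lariat_words n = {c # b # a # w | a b c w.
     a # w \<in> path_words (n + 1) \<and> b \<ge> 1 \<and> c \<ge> 1 \<and> a \<noteq> b \<and> a \<noteq> c \<and> b \<noteq> c}"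

lemma fst_lariat: "fst (lariat n) = Inl ` {1..3} \<union> Inr ` {1..n}"
  by (auto simp: lariat_def lollipop_def disjoint_union_def complete_graph_def path_graph_def Let_def)

lemma edges_lariat:
  "{Inl i, Inl j} \<in> snd (lariat n) \<longleftrightarrow> i \<in> {1..3} \<and> j \<in> {1..3} \<and> i \<noteq> j"
  "{Inr u, Inr v} \<in> snd (lariat n) \<longleftrightarrow> {u, v} \<in> snd (path_graph n)"
  "{Inl i, Inr v} \<in> snd (lariat n) \<longleftrightarrow> n \<ge> 1 \<and> i = 1 \<and> v = 1"
  "{Inr v, Inl i} \<in> snd (lariat n) \<longleftrightarrow> n \<ge> 1 \<and> i = 1 \<and> v = 1"
proof -
  have E: "snd (lariat n) = image Inl ` snd (complete_graph 3) \<union> image Inr ` snd (path_graph n)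
      \<union> (if n = 0 then {} else {{Inl 1, Inr 1}})"
    by (simp add: lariat_def lollipop_def disjoint_union_def Let_def)
  have "inj ((`) (Inl :: nat \<Rightarrow> nat + nat))" "inj ((`) (Inr :: nat \<Rightarrow> nat + nat))"
    by (auto simp: inj_on_def inj_image_eq_iff)
  note inj = inj_image_mem_iff[OF this(1)] inj_image_mem_iff[OF this(2)]
  have same: "{Inl i, Inl j :: nat + nat} \<in> image Inl ` X \<longleftrightarrow> {i, j} \<in> X"
    "{Inr i, Inr j :: nat + nat} \<in> image Inr ` X \<longleftrightarrow> {i, j} \<in> X" for i j :: nat and X :: "nat set set"
    using inj(1)[of "{i, j}" X] inj(2)[of "{i, j}" X] by simp_all
  have mixed: "A \<notin> image Inl ` X" if "Inr v \<in> A" for A :: "(nat + nat) set" and v X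
    using that by auto
  have mixed': "A \<notin> image Inr ` X" if "Inl v \<in> A" for A :: "(nat + nat) set" and v X
    using that by auto
  have "{i, j} \<in> snd (complete_graph 3) \<longleftrightarrow> i \<in> {1..3} \<and> j \<in> {1..3} \<and> i \<noteq> j"
    by (auto simp: complete_graph_def doubleton_eq_iff)
  then show "{Inl i, Inl j} \<in> snd (lariat n) \<longleftrightarrow> i \<in> {1..3} \<and> j \<in> {1..3} \<and> i \<noteq> j"
    by (simp add: E same mixed'[of i] doubleton_eq_iff)
  show "{Inr u, Inr v} \<in> snd (lariat n) \<longleftrightarrow> {u, v} \<in> snd (path_graph n)"
    by (simp add: E same mixed[of u] doubleton_eq_iff)
  show "{Inl i, Inr v} \<in> snd (lariat n) \<longleftrightarrow> n \<ge> 1 \<and> i = 1 \<and> v = 1"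
    "{Inr v, Inl i} \<in> snd (lariat n) \<longleftrightarrow> n \<ge> 1 \<and> i = 1 \<and> v = 1"
    by (auto simp: E mixed[of v] mixed'[of i] doubleton_eq_iff)
qed

lemma Cons_in_path_words:
  "a # w \<in> path_words (Suc n) \<longleftrightarrow> w \<in> path_words n \<and> a \<ge> 1 \<and> (w = [] \<or> a \<noteq> hd w)"
  by (auto simp: path_words_def distinct_adj_Cons)

lemma lariat_colourings_words:
  "(\<lambda>\<kappa>. map \<kappa> (Inl 3 # Inl 2 # Inl 1 # map Inr [1..<Suc n])) ` proper_colourings (lariat n)
     = lariat_words n" (is "?L = _")
proof (intro equalityI subsetI)
  fix xs assume "xs \<in> ?L"
  then obtain \<kappa> where \<kappa>: "\<kappa> \<in> proper_colourings (lariat n)"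
    and xs: "xs = map \<kappa> (Inl 3 # Inl 2 # Inl 1 # map Inr [1..<Suc n])" by blast
  have pos: "\<kappa> v \<ge> 1" if "v \<in> fst (lariat n)" for v
    using \<kappa> that by (auto simp: proper_colourings_def)
  have adj: "\<kappa> u \<noteq> \<kappa> v" if "{u, v} \<in> snd (lariat n)" for u v
    using \<kappa> that by (auto simp: proper_colourings_def)
  define w where "w = map (\<kappa> \<circ> Inr) [1..<Suc n]"
  let ?\<kappa> = "restrict (\<kappa> \<circ> Inr) {1..n}"
  have "?\<kappa> u \<noteq> ?\<kappa> v" if e: "{u, v} \<in> snd (path_graph n)" for u v
  proof -
    have "u \<in> {1..n}" "v \<in> {1..n}" using e by (auto simp: edges_path_graph)
    then show ?thesis using adj[of "Inr u" "Inr v"] e by (simp add: edges_lariat)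
  qed
  moreover have "?\<kappa> \<in> fst (path_graph n) \<rightarrow>\<^sub>E {1..}"
    using pos by (auto simp: path_graph_def fst_lariat)
  ultimately have "?\<kappa> \<in> proper_colourings (path_graph n)"
    unfolding proper_colourings_def by blast
  moreover have "w = map ?\<kappa> [1..<Suc n]" by (auto simp: w_def simp del: upt_Suc)
  ultimately have w: "w \<in> path_words n" unfolding path_colourings_words[symmetric] by blast
  \<comment> \<open>The connecting edge exists only for \<open>n \<ge> 1\<close>; for
    \<open>n = 0\<close> the word \<open>w\<close> is empty.\<close>
  have "w = [] \<or> \<kappa> (Inl 1) \<noteq> hd w"
  proof (cases "n = 0")
    case False
    then have "hd w = \<kappa> (Inr 1)" by (simp add: w_def hd_map upt_conv_Cons del: upt_Suc)
    then show ?thesis using adj[of "Inl 1" "Inr 1"] False by (simp add: edges_lariat)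
  qed (simp add: w_def)
  then have "\<kappa> (Inl 1) # w \<in> path_words (n + 1)"
    using w pos[of "Inl 1"] by (simp add: Cons_in_path_words fst_lariat)
  moreover have "xs = \<kappa> (Inl 3) # \<kappa> (Inl 2) # \<kappa> (Inl 1) # w"
    by (simp add: xs w_def del: upt_Suc)
  ultimately show "xs \<in> lariat_words n"
    using pos[of "Inl 2"] pos[of "Inl 3"] adj[of "Inl 1" "Inl 2"] adj[of "Inl 1" "Inl 3"]
      adj[of "Inl 2" "Inl 3"] by (simp add: lariat_words_def fst_lariat edges_lariat)
next
  fix xs assume "xs \<in> lariat_words n"
  then obtain a b c w where xs: "xs = c # b # a # w" and aw: "a # w \<in> path_words (Suc n)"
    and bc: "b \<ge> 1" "c \<ge> 1" "a \<noteq> b" "a \<noteq> c" "b \<noteq> c" by (auto simp: lariat_words_def)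
  obtain \<kappa>' where \<kappa>': "\<kappa>' \<in> proper_colourings (path_graph n)" and w: "w = map \<kappa>' [1..<Suc n]"
    using aw path_colourings_words[of n] unfolding Cons_in_path_words by blast
  \<comment> \<open>The path part keeps \<open>\<kappa>'\<close>, which is already extensional;
    \<open>undefined\<close> is the value that extensionality demands on the other
    \<open>Inl\<close> arguments.\<close>
  define \<kappa> where "\<kappa> = case_sum (\<lambda>i::nat. if i = 1 then a else if i = 2 then b else if i = 3 then c
    else undefined) \<kappa>'"
  have three: "i \<in> {1..3} \<longleftrightarrow> i = 1 \<or> i = 2 \<or> i = 3" for i :: nat by auto
  have "\<kappa> \<in> fst (lariat n) \<rightarrow>\<^sub>E {1..}"
  proof (rule PiE_I)
    show "\<kappa> v \<in> {1..}" if "v \<in> fst (lariat n)" for v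
      using that bc aw \<kappa>' unfolding fst_lariat three Cons_in_path_words
      by (auto simp: \<kappa>_def three proper_colourings_def path_graph_def)
    show "\<kappa> v = undefined" if "v \<notin> fst (lariat n)" for v
    proof (cases v)
      case (Inl i)
      then show ?thesis using that by (auto simp: \<kappa>_def fst_lariat)
    next
      case (Inr i)
      then show ?thesis using that \<kappa>'
        by (auto simp: \<kappa>_def fst_lariat proper_colourings_def path_graph_def intro: PiE_arb)
    qed
  qed
  moreover have "\<kappa> u \<noteq> \<kappa> v" if e: "{u, v} \<in> snd (lariat n)" for u v
  proof -
    have hd: "a \<noteq> \<kappa>' (Suc 0)" if "n \<ge> 1"
      using that aw by (simp add: Cons_in_path_words w hd_map upt_conv_Cons del: upt_Suc)
    show ?thesis
    proof (cases u; cases v)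
      fix i j assume uv: "u = Inl i" "v = Inl j"
      show ?thesis using e bc unfolding uv edges_lariat three by (auto simp: \<kappa>_def)
    next
      fix i j assume "u = Inr i" "v = Inr j"
      then show ?thesis using e \<kappa>' by (auto simp: edges_lariat \<kappa>_def proper_colourings_def)
    qed (use e hd in \<open>auto simp: edges_lariat \<kappa>_def\<close>)
  qed
  ultimately have "\<kappa> \<in> proper_colourings (lariat n)" unfolding proper_colourings_def by blast
  moreover have "xs = map \<kappa> (Inl 3 # Inl 2 # Inl 1 # map Inr [1..<Suc n])"
    by (simp add: xs w \<kappa>_def del: upt_Suc)
  ultimately show "xs \<in> ?L" by blast
qed

lemma chromatic_sym_lariat: "chromatic_sym (lariat n) = weight_gf (lariat_words n) word_monomial"
proof -
  have "set (Inl 3 # Inl 2 # Inl 1 # map Inr [1..<Suc n]) = fst (lariat n)"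
    by (auto simp: fst_lariat image_iff simp del: upt_Suc)
  moreover have "distinct (Inl (3::nat) # Inl 2 # Inl 1 # map Inr [1..<Suc n])"
    by (auto simp: distinct_map simp del: upt_Suc)
  ultimately show ?thesis
    using chromatic_sym_eq_weight_gf lariat_colourings_words by metis
qed

section \<open>The two recurrences\<close>

text \<open>The mark accounts for the factor \<open>k\<close> in
  \<open>of_nat k * elem_sym k\<close>.\<close>

definition marked_subsets :: "nat \<Rightarrow> (nat set \<times> nat) set" where
  "marked_subsets k = Sigma (subsets_of_card k) (\<lambda>S. S)"

lemma fibre_marked_subsets:
  "{p \<in> marked_subsets k. squarefree_monomial (fst p) = m}
     = Sigma {S \<in> subsets_of_card k. squarefree_monomial S = m} (\<lambda>S. S)"
  by (auto simp: marked_subsets_def)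

lemma finite_fibres_marked_subsets:
  "finite_fibres (marked_subsets k) (\<lambda>p. squarefree_monomial (fst p))"
  using finite_fibres_subsets[of k] unfolding finite_fibres_def fibre_marked_subsets
  by (auto simp: subsets_of_card_def intro!: finite_SigmaI)

lemma weight_gf_marked_subsets:
  "weight_gf (marked_subsets k) (\<lambda>p. squarefree_monomial (fst p)) = of_nat k * elem_sym k"
proof (rule mseries_eqI)
  fix m
  let ?F = "{S \<in> subsets_of_card k. squarefree_monomial S = m}"
  have "card (Sigma ?F (\<lambda>S. S)) = (\<Sum>S\<in>?F. card S)"
    using finite_fibres_subsets[of k] by (intro card_SigmaI) (auto simp: finite_fibres_def subsets_of_card_def)
  also have "\<dots> = k * card ?F" by (simp add: subsets_of_card_def)
  finally show "mcoeff (weight_gf (marked_subsets k) (\<lambda>p. squarefree_monomial (fst p))) m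
      = mcoeff (of_nat k * elem_sym k) m"
    by (simp add: mcoeff_weight_gf fibre_marked_subsets mscale_of_nat[symmetric] mscale.rep_eq
        elem_sym_eq_weight_gf)
qed

lemma squarefree_monomial_insert:
  "finite S \<Longrightarrow> s \<notin> S \<Longrightarrow> squarefree_monomial (insert s S) = Poly_Mapping.single s 1 + squarefree_monomial S"
  by (simp add: squarefree_monomial_def)

text \<open>If the marked element of \<open>S\<close> differs from the first letter of the word, it can be moved in front
  of the word; otherwise the mark is redundant. This matches marked subsets with nonempty words.\<close>

lemma path_recurrence_aux:
  "(\<Sum>k\<in>{1..n}. of_nat k * elem_sym k * chromatic_sym (path_graph (n - k)))
     = (\<Sum>k\<in>{..<n}. elem_sym k * chromatic_sym (path_graph (n - k)))"
proof -
  let ?v = "\<lambda>(p, xs). squarefree_monomial (fst p) + word_monomial xs"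
  let ?w = "\<lambda>(S, xs). squarefree_monomial S + word_monomial xs"
  let ?A = "\<lambda>k. marked_subsets k \<times> path_words (n - k)"
  let ?B = "\<lambda>k. subsets_of_card k \<times> path_words (n - k)"
  let ?h = "\<lambda>((S, s), xs). if xs \<noteq> [] \<and> hd xs = s then (S, xs) else (S - {s}, s # xs)"
  \<comment> \<open>Whether the first letter lies in the set tells the two cases of
    \<open>?h\<close> apart: in the first it is the marked element, in the second it has just left
    the set.\<close>
  let ?h' = "\<lambda>(S, xs). if hd xs \<in> S then ((S, hd xs), xs) else ((insert (hd xs) S, hd xs), tl xs)"
  \<comment> \<open>A mark forces \<open>k \<ge> 1\<close>, and \<open>k < n\<close> says that the
    word is nonempty, so both ranges of \<open>k\<close> become conditions on the pairs.\<close>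
  have A: "((S, s), xs) \<in> (\<Union>k\<in>{1..n}. ?A k) \<longleftrightarrow> S \<subseteq> {1..} \<and> finite S \<and> s \<in> S
      \<and> card S + length xs = n \<and> set xs \<subseteq> {1..} \<and> distinct_adj xs" for S s xs
    by (auto simp: marked_subsets_def subsets_of_card_def path_words_def card_gt_0_iff Suc_le_eq)
  have B: "(S, xs) \<in> (\<Union>k\<in>{..<n}. ?B k) \<longleftrightarrow> S \<subseteq> {1..} \<and> finite S \<and> xs \<noteq> []
      \<and> card S + length xs = n \<and> set xs \<subseteq> {1..} \<and> distinct_adj xs" for S xs
    by (auto simp: subsets_of_card_def path_words_def)
  have "bij_betw ?h (\<Union>k\<in>{1..n}. ?A k) (\<Union>k\<in>{..<n}. ?B k)"
  proof (rule bij_betw_byWitness[where f' = ?h'])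
    show "\<forall>p\<in>(\<Union>k\<in>{1..n}. ?A k). ?h' (?h p) = p"
    proof
      fix p assume p: "p \<in> (\<Union>k\<in>{1..n}. ?A k)"
      obtain S s xs where "p = ((S, s), xs)" by (metis prod.collapse)
      then show "?h' (?h p) = p" using p A[of S s xs] by (auto simp: insert_absorb)
    qed
    show "\<forall>p\<in>(\<Union>k\<in>{..<n}. ?B k). ?h (?h' p) = p"
    proof
      fix p assume p: "p \<in> (\<Union>k\<in>{..<n}. ?B k)"
      obtain S xs where S: "p = (S, xs)" by (metis prod.collapse)
      then obtain x ys where "xs = x # ys" using p B[of S xs] by (cases xs) auto
      then show "?h (?h' p) = p" using S p B[of S xs] by (auto simp: distinct_adj_Cons)
    qed
    show "?h ` (\<Union>k\<in>{1..n}. ?A k) \<subseteq> (\<Union>k\<in>{..<n}. ?B k)"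
    proof
      fix q assume "q \<in> ?h ` (\<Union>k\<in>{1..n}. ?A k)"
      then obtain p where p: "p \<in> (\<Union>k\<in>{1..n}. ?A k)" "q = ?h p" by blast
      obtain S s xs where S: "p = ((S, s), xs)" by (metis prod.collapse)
      note pA = p(1)[unfolded S A]
      show "q \<in> (\<Union>k\<in>{..<n}. ?B k)"
      proof (cases "xs \<noteq> [] \<and> hd xs = s")
        case True
        then have "q = (S, xs)" using p S by simp
        then show ?thesis using pA True by (simp only: B) simp
      next
        case False
        then have "q = (S - {s}, s # xs)" using p S by auto
        moreover have "card S = Suc (card (S - {s}))" using pA by (metis card.remove)
        ultimately show ?thesis using pA False by (simp only: B) (auto simp: distinct_adj_Cons)
      qed
    qed
    show "?h' ` (\<Union>k\<in>{..<n}. ?B k) \<subseteq> (\<Union>k\<in>{1..n}. ?A k)"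
    proof
      fix q assume "q \<in> ?h' ` (\<Union>k\<in>{..<n}. ?B k)"
      then obtain p where p: "p \<in> (\<Union>k\<in>{..<n}. ?B k)" "q = ?h' p" by blast
      obtain S xs where S: "p = (S, xs)" by (metis prod.collapse)
      note pB = p(1)[unfolded S B]
      then obtain x ys where xs: "xs = x # ys" by (cases xs) auto
      show "q \<in> (\<Union>k\<in>{1..n}. ?A k)"
      proof (cases "x \<in> S")
        case True
        then have "q = ((S, x), xs)" using p S xs by simp
        then show ?thesis using pB True by (simp only: A)
      next
        case False
        then have "q = ((insert x S, x), ys)" using p S xs by simp
        then show ?thesis using pB False xs by (simp only: A) (auto simp: distinct_adj_Cons)
      qed
    qed
  qed
  moreover have "?w (?h p) = ?v p" if p: "p \<in> (\<Union>k\<in>{1..n}. ?A k)" for p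
  proof -
    obtain S s xs where S: "p = ((S, s), xs)" by (metis prod.collapse)
    then have "finite S" "s \<in> S" using p A[of S s xs] by auto
    then have "squarefree_monomial S = Poly_Mapping.single s 1 + squarefree_monomial (S - {s})"
      using squarefree_monomial_insert[of "S - {s}" s] by (simp add: insert_absorb)
    then show ?thesis by (simp add: S algebra_simps)
  qed
  ultimately have "weight_gf (\<Union>k\<in>{1..n}. ?A k) ?v = weight_gf (\<Union>k\<in>{..<n}. ?B k) ?w"
    by (rule weight_gf_cong_bij)
  moreover have "weight_gf (\<Union>k\<in>{1..n}. ?A k) ?v = (\<Sum>k\<in>{1..n}. weight_gf (?A k) ?v)"
    by (intro weight_gf_UN finite_fibres_Times finite_fibres_marked_subsets finite_fibres_path_words)
       (auto simp: disjoint_family_on_def marked_subsets_def subsets_of_card_def)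
  moreover have "weight_gf (\<Union>k\<in>{..<n}. ?B k) ?w = (\<Sum>k\<in>{..<n}. weight_gf (?B k) ?w)"
    by (intro weight_gf_UN finite_fibres_Times finite_fibres_subsets finite_fibres_path_words)
       (auto simp: disjoint_family_on_def subsets_of_card_def)
  ultimately show ?thesis
    unfolding chromatic_sym_path weight_gf_marked_subsets[symmetric] unfolding elem_sym_eq_weight_gf
    by (simp add: weight_gf_times finite_fibres_marked_subsets finite_fibres_subsets finite_fibres_path_words)
qed

lemma weight_gf_single_0:
  assumes "w a = 0"
  shows "weight_gf {a} w = 1"
proof (rule mseries_eqI)
  fix m
  have "{x \<in> {a}. w x = m} = (if m = 0 then {a} else {})" using assms by auto
  then show "mcoeff (weight_gf {a} w) m = mcoeff 1 m"
    unfolding mcoeff_weight_gf one_mseries.rep_eq by simp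
qed

lemma elem_sym_0: "elem_sym 0 = 1"
proof -
  have "subsets_of_card 0 = {{}}" by (auto simp: subsets_of_card_def)
  then show ?thesis
    by (simp add: elem_sym_eq_weight_gf weight_gf_single_0 squarefree_monomial_def)
qed

lemma chromatic_sym_path_0: "chromatic_sym (path_graph 0) = 1"
proof -
  have "path_words 0 = {[]}" by (auto simp: path_words_def)
  then show ?thesis by (simp add: chromatic_sym_path weight_gf_single_0)
qed

text \<open>Subtract the sum of \<open>?t k\<close> over \<open>{1..n}\<close> from both sides of
  \<open>path_recurrence_aux\<close>. On the right, \<open>{..<n}\<close> against
  \<open>{1..n}\<close> leaves the term \<open>k = 0\<close>, the path itself, minus the term
  \<open>k = n\<close>, which is \<open>elem_sym n\<close>.\<close>

lemma path_recurrence: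
  "chromatic_sym (path_graph n)
     = elem_sym n + (\<Sum>k\<in>{1..n}. of_nat (k - 1) * (elem_sym k * chromatic_sym (path_graph (n - k))))"
proof (cases "n = 0")
  case True
  then show ?thesis by (simp add: elem_sym_0 chromatic_sym_path_0)
next
  case False
  let ?t = "\<lambda>k. elem_sym k * chromatic_sym (path_graph (n - k))"
  have "(\<Sum>k\<in>{1..n}. of_nat k * ?t k) = (\<Sum>k\<in>{1..n}. of_nat (k - 1) * ?t k) + (\<Sum>k\<in>{1..n}. ?t k)"
    unfolding sum.distrib[symmetric]
    by (rule sum.cong) (auto simp: of_nat_diff algebra_simps)
  moreover have "(\<Sum>k\<in>{1..n}. of_nat k * ?t k) = (\<Sum>k\<in>{..<n}. ?t k)"
    using path_recurrence_aux[of n] by (simp add: mult.assoc)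
  moreover have "(\<Sum>k\<in>{..<n}. ?t k) + ?t n = ?t 0 + (\<Sum>k\<in>{1..n}. ?t k)"
    using sum.lessThan_Suc[of ?t n] sum.lessThan_Suc_shift[of ?t n]
    unfolding One_nat_def sum.atLeast1_atMost_eq by simp
  ultimately have "chromatic_sym (path_graph n) + (\<Sum>k\<in>{1..n}. ?t k)
      = (elem_sym n + (\<Sum>k\<in>{1..n}. of_nat (k - 1) * ?t k)) + (\<Sum>k\<in>{1..n}. ?t k)"
    by (simp add: elem_sym_0 chromatic_sym_path_0 ac_simps)
  then show ?thesis by (rule add_right_imp_eq)
qed

section \<open>Triple deletion at the triangle\<close>

lemma word_monomial_append: "word_monomial (xs @ ys) = word_monomial xs + word_monomial ys"
  by (simp add: word_monomial_def)

text \<open>Let \<open>cba\<close> be the colours of the triangle, where the path is attached to the vertex coloured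
  \<open>a\<close>. With \<open>Q\<close> counting the words with \<open>c = a\<close>, path words give \<open>L + Q\<close>, while dropping the
  edge \<open>ba\<close> instead gives \<open>L + 2 Q\<close>.\<close>

lemma lariat_eq:
  "chromatic_sym (lariat n) = 2 * chromatic_sym (path_graph (n + 3))
     - 2 * (elem_sym 2 * chromatic_sym (path_graph (n + 1)))"
proof -
  \<comment> \<open>In \<open>Q\<close> only the edge \<open>ca\<close> of the triangle fails, in
    \<open>R\<close> only the edge \<open>ba\<close>.\<close>
  define Q where "Q = {a # b # a # w | a b w. a # w \<in> path_words (n + 1) \<and> b \<ge> 1 \<and> a \<noteq> b}"
  define R where "R = {b # a # a # w | a b w. a # w \<in> path_words (n + 1) \<and> b \<ge> 1 \<and> a \<noteq> b}"
  let ?W = "{xs. length xs = n + 3}"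
  have len: "lariat_words n \<subseteq> ?W" "Q \<subseteq> ?W" "R \<subseteq> ?W"
    by (auto simp: lariat_words_def Q_def R_def path_words_def)
  have fin: "finite_fibres A word_monomial" if "A \<subseteq> ?W" for A
    using finite_fibres_subset[OF finite_fibres_words that] .
  have ex3: "xs \<in> path_words (n + 3) \<Longrightarrow> \<exists>c b a w. xs = c # b # a # w" for xs
    by (simp add: path_words_def eval_nat_numeral length_Suc_conv) blast
  have P3: "path_words (n + 3) = lariat_words n \<union> Q"
  proof (intro equalityI subsetI)
    fix xs assume xs: "xs \<in> path_words (n + 3)"
    then obtain c b a w where "xs = c # b # a # w" using ex3 by blast
    then show "xs \<in> lariat_words n \<union> Q"
      using xs by (auto simp: lariat_words_def Q_def Cons_in_path_words eval_nat_numeral)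
  qed (auto simp: lariat_words_def Q_def Cons_in_path_words eval_nat_numeral)
  have P: "chromatic_sym (path_graph (n + 3)) = chromatic_sym (lariat n) + weight_gf Q word_monomial"
    unfolding chromatic_sym_path chromatic_sym_lariat P3
    using len by (intro weight_gf_Un fin) (auto simp: lariat_words_def Q_def)
  \<comment> \<open>Without the edge \<open>ba\<close>, the vertices coloured \<open>c\<close> and
    \<open>b\<close> form a path on two vertices beside one on \<open>n + 1\<close>. Since
    \<open>c \<noteq> b\<close>, at most one of \<open>ca\<close> and \<open>ba\<close> can
    fail.\<close>
  have app: "(\<lambda>(xs, ys). xs @ ys) ` (path_words 2 \<times> path_words (n + 1)) = (lariat_words n \<union> Q) \<union> R"
  proof (intro equalityI subsetI)
    fix zs assume "zs \<in> (\<lambda>(xs, ys). xs @ ys) ` (path_words 2 \<times> path_words (n + 1))"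
    then obtain xs ys where zs: "zs = xs @ ys" "xs \<in> path_words 2" "ys \<in> path_words (n + 1)" by auto
    obtain c b where "xs = [c, b]" "c \<noteq> b" "c \<ge> 1" "b \<ge> 1"
      using zs(2) by (auto simp: path_words_def eval_nat_numeral length_Suc_conv)
    moreover obtain a w where "ys = a # w" using zs(3) by (cases ys) (auto simp: path_words_def)
    ultimately show "zs \<in> (lariat_words n \<union> Q) \<union> R"
      using zs(1,3) by (auto simp: lariat_words_def Q_def R_def)
  next
    fix zs assume "zs \<in> (lariat_words n \<union> Q) \<union> R"
    then obtain a b c w where zs: "zs = [c, b] @ (a # w)" "a # w \<in> path_words (n + 1)"
      "b \<ge> 1" "c \<ge> 1" "b \<noteq> c"
      by (auto simp: lariat_words_def Q_def R_def Cons_in_path_words)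
    then have "([c, b], a # w) \<in> path_words 2 \<times> path_words (n + 1)"
      by (simp add: path_words_def)
    then show "zs \<in> (\<lambda>(xs, ys). xs @ ys) ` (path_words 2 \<times> path_words (n + 1))"
      unfolding zs(1) by (rule image_eqI[rotated]) simp
  qed
  have "inj_on (\<lambda>(xs, ys). xs @ ys) (path_words 2 \<times> path_words (n + 1))"
    by (auto simp: inj_on_def path_words_def)
  then have "bij_betw (\<lambda>(xs, ys). xs @ ys) (path_words 2 \<times> path_words (n + 1)) ((lariat_words n \<union> Q) \<union> R)"
    using app by (simp add: bij_betw_def)
  then have "chromatic_sym (path_graph 2) * chromatic_sym (path_graph (n + 1))
      = weight_gf ((lariat_words n \<union> Q) \<union> R) word_monomial"
    unfolding chromatic_sym_path weight_gf_times[OF finite_fibres_path_words finite_fibres_path_words]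
    by (rule weight_gf_cong_bij) (auto simp: word_monomial_append)
  also have "\<dots> = weight_gf (lariat_words n \<union> Q) word_monomial + weight_gf R word_monomial"
    using len by (intro weight_gf_Un fin) (auto simp: lariat_words_def Q_def R_def)
  also have "weight_gf R word_monomial = weight_gf Q word_monomial"
  proof (rule weight_gf_cong_bij)
    \<comment> \<open>Exchanging the colours \<open>c\<close> and \<open>b\<close> exchanges the two
      failing edges.\<close>
    let ?s = "\<lambda>xs. xs ! 1 # xs ! 0 # drop 2 xs :: nat list"
    show "bij_betw ?s R Q"
      by (rule bij_betw_byWitness[where f' = ?s]) (auto simp: Q_def R_def)
  qed (auto simp: R_def algebra_simps)
  also have "weight_gf (lariat_words n \<union> Q) word_monomial = chromatic_sym (path_graph (n + 3))"
    by (simp add: chromatic_sym_path P3)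
  finally have "chromatic_sym (path_graph 2) * chromatic_sym (path_graph (n + 1))
      = chromatic_sym (path_graph (n + 3)) + weight_gf Q word_monomial" .
  \<comment> \<open>The factor \<open>k - 1\<close> kills \<open>k = 1\<close>, and
    \<open>k = 2\<close> repeats the initial \<open>elem_sym 2\<close>.\<close>
  moreover have "chromatic_sym (path_graph 2) = 2 * elem_sym 2"
    using path_recurrence[of 2] by (simp add: eval_nat_numeral chromatic_sym_path_0)
  ultimately show ?thesis using P by (simp add: algebra_simps)
qed

section \<open>Comparison of coefficients\<close>

lemma elem_sym_eq_part: "elem_sym n = elem_sym_part (if n = 0 then {#} else {#n#})"
  by (simp add: elem_sym_part_def elem_sym_0)

lemma elem_sym_in_span: "elem_sym n \<in> e_span"
  unfolding elem_sym_eq_part by (rule elem_sym_part_in_span) (simp add: partitions_def)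

text \<open>\<open>e_coeff\<close> is 0 by default outside the span; this makes the coefficients of
  paths, and through \<open>lariat_eq\<close> those of lariats, genuine.\<close>

lemma path_in_span: "chromatic_sym (path_graph n) \<in> e_span"
proof (induction n rule: less_induct)
  case (less n)
  then show ?case
    unfolding path_recurrence[of n] mscale_of_nat[symmetric]
    by (intro mseries.span_add mseries.span_sum mseries.span_scale elem_sym_times_in_span
        elem_sym_in_span) auto
qed

definition path_coeff :: "nat \<Rightarrow> nat multiset \<Rightarrow> rat" where
  "path_coeff n la = e_coeff (chromatic_sym (path_graph n)) la"

text \<open>In \<open>path_recurrence\<close> the product with \<open>elem_sym k\<close> contributes
  only if \<open>k\<close> is a part, so the sum runs over the distinct parts, each taken once
  whatever its multiplicity.\<close>

lemma path_coeff_rec: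
  assumes la: "la \<in> partitions"
  shows "path_coeff n la = (if la = (if n = 0 then {#} else {#n#}) then 1 else 0)
    + (\<Sum>k\<in>set_mset la. if k \<le> n then of_nat (k - 1) * path_coeff (n - k) (la - {#k#}) else 0)"
proof -
  let ?f = "\<lambda>k. of_nat (k - 1) * (if k \<in># la then path_coeff (n - k) (la - {#k#}) else 0)"
  let ?t = "\<lambda>k. mscale (of_nat (k - 1)) (elem_sym k * chromatic_sym (path_graph (n - k)))"
  have t: "?t k \<in> e_span" "e_coeff (?t k) la = ?f k" if "k \<in> {1..n}" for k
  proof -
    have "k \<ge> 1" using that by simp
    note span = elem_sym_times_in_span[OF this path_in_span]
      and coeff = e_coeff_elem_sym_times[OF this path_in_span la]
    show "?t k \<in> e_span" by (rule mseries.span_scale[OF span])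
    show "e_coeff (?t k) la = ?f k" unfolding e_coeff_scale[OF span] coeff path_coeff_def ..
  qed
  have "path_coeff n la = e_coeff (elem_sym n + (\<Sum>k\<in>{1..n}. ?t k)) la"
    unfolding path_coeff_def path_recurrence[of n] mscale_of_nat ..
  also have "\<dots> = e_coeff (elem_sym n) la + e_coeff (\<Sum>k\<in>{1..n}. ?t k) la"
    by (intro e_coeff_add elem_sym_in_span mseries.span_sum t)
  also have "e_coeff (\<Sum>k\<in>{1..n}. ?t k) la = (\<Sum>k\<in>{1..n}. e_coeff (?t k) la)"
    by (intro e_coeff_sum t) simp
  also have "\<dots> = (\<Sum>k\<in>{1..n}. ?f k)" by (intro sum.cong t) simp
  finally have "path_coeff n la = e_coeff (elem_sym n) la + (\<Sum>k\<in>{1..n}. ?f k)" .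
  moreover have "(\<Sum>k\<in>{1..n}. ?f k) = (\<Sum>k\<in>set_mset la \<inter> {..n}. ?f k)"
    by (rule sum.mono_neutral_right) (use la in \<open>auto simp: partitions_def Suc_le_eq intro!: gr0I\<close>)
  moreover have "\<dots> = (\<Sum>k\<in>set_mset la. if k \<le> n then ?f k else 0)"
    unfolding sum.inter_restrict[OF finite_set_mset] atMost_iff ..
  moreover have "\<dots> = (\<Sum>k\<in>set_mset la. if k \<le> n
      then of_nat (k - 1) * path_coeff (n - k) (la - {#k#}) else 0)"
    by (intro sum.cong refl) simp
  moreover have "e_coeff (elem_sym n) la = (if la = (if n = 0 then {#} else {#n#}) then 1 else 0)"
    unfolding elem_sym_eq_part by (rule e_coeff_elem_sym_part[OF la]) (simp add: partitions_def)
  ultimately show ?thesis by simp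
qed

lemma partitions_diff: "la \<in> partitions \<Longrightarrow> la - mu \<in> partitions"
  by (auto simp: partitions_def dest: in_diffD)

text \<open>The recurrence has no negative factor, and each removal of a part shortens the
  partition.\<close>

lemma path_coeff_nonneg: "la \<in> partitions \<Longrightarrow> path_coeff n la \<ge> 0"
proof (induction "size la" arbitrary: la n rule: less_induct)
  case less
  have "path_coeff (n - k) (la - {#k#}) \<ge> 0" if "k \<in># la" for k
    using less that by (simp add: size_Diff1_less partitions_diff)
  then show ?case
    unfolding path_coeff_rec[OF less(2), of n] by (intro add_nonneg_nonneg sum_nonneg) auto
qed

text \<open>A single summand of a nonnegative sum. For \<open>k = 2\<close> it bounds half the
  correction term in \<open>lariat_coeff\<close> by the path coefficient.\<close>

lemma path_coeff_remove_le:
  assumes la: "la \<in> partitions" and k: "k \<in># la" "k \<le> n"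
  shows "of_nat (k - 1) * path_coeff (n - k) (la - {#k#}) \<le> path_coeff n la"
proof -
  let ?f = "\<lambda>k. if k \<le> n then of_nat (k - 1) * path_coeff (n - k) (la - {#k#}) else 0"
  have "?f k \<le> (\<Sum>k\<in>set_mset la. ?f k)"
    using k path_coeff_nonneg[OF partitions_diff[OF la]] by (intro member_le_sum) auto
  then show ?thesis unfolding path_coeff_rec[OF la, of n] using k by auto
qed

lemma lariat_coeff:
  assumes la: "la \<in> partitions"
  shows "e_coeff (chromatic_sym (lariat n)) la
    = 2 * path_coeff (n + 3) la - (if 2 \<in># la then 2 * path_coeff (n + 1) (la - {#2#}) else 0)"
proof -
  have two: "2 * f = mscale 2 f" for f using mscale_of_nat[of 2 f] by simp
  show ?thesis
    unfolding lariat_eq two path_coeff_def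
    using la by (simp add: e_coeff_diff e_coeff_scale path_in_span mseries.span_scale
        elem_sym_times_in_span e_coeff_elem_sym_times)
qed

text \<open>The summand of the path recurrence belonging to the part 2 cancels against the correction
  term.\<close>

lemma lariat_coeff_add_2:
  assumes mu: "mu \<in> partitions"
  shows "e_coeff (chromatic_sym (lariat n)) (add_mset 2 mu)
    = 2 * (\<Sum>k\<in>set_mset mu - {2}. if k \<le> n + 3
        then of_nat (k - 1) * path_coeff (n + 3 - k) (add_mset 2 mu - {#k#}) else 0)"
proof -
  have la: "add_mset 2 mu \<in> partitions" using mu by (simp add: partitions_def)
  let ?f = "\<lambda>k. if k \<le> n + 3
    then of_nat (k - 1) * path_coeff (n + 3 - k) (add_mset 2 mu - {#k#}) else 0"
  have "(\<Sum>k\<in>set_mset (add_mset 2 mu). ?f k)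
      = ?f 2 + (\<Sum>k\<in>set_mset (add_mset 2 mu) - {2}. ?f k)"
    by (rule sum.remove) auto
  moreover have "set_mset (add_mset 2 mu) - {2} = set_mset mu - {2}" by auto
  moreover have "?f 2 = path_coeff (n + 1) mu" by (simp add: eval_nat_numeral)
  ultimately show ?thesis
    unfolding lariat_coeff[OF la] path_coeff_rec[OF la, of "n + 3"] by simp
qed

section \<open>Explicit coefficients of particular partitions\<close>

lemma path_coeff_empty: "path_coeff n {#} = (if n = 0 then 1 else 0)"
  using path_coeff_rec[of "{#}" n] by (auto simp: partitions_def)

lemma path_coeff_single: "a \<ge> 1 \<Longrightarrow> path_coeff a {#a#} = of_nat a"
  using path_coeff_rec[of "{#a#}" a] by (auto simp: partitions_def path_coeff_empty of_nat_diff)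

lemma path_coeff_2_1: "path_coeff 3 {#2, 1#} = 1"
  using path_coeff_rec[of "{#2, 1#}" 3] path_coeff_single[of 1] by (simp add: partitions_def)

lemma path_coeff_2_2: "path_coeff 4 {#2, 2#} = 2"
  using path_coeff_rec[of "{#2, 2#}" 4] path_coeff_single[of 2] by (simp add: partitions_def)

text \<open>Only \<open>k = n + 1\<close> occurs in \<open>lariat_coeff_add_2\<close>, with factor
  \<open>n\<close> and the remaining \<open>{#2#}\<close> of path coefficient 2. For
  \<open>n = 1\<close> this part is itself 2 and drops out of the sum.\<close>

lemma lariat_coeff_3:
  assumes "n \<noteq> 1"
  shows "e_coeff (chromatic_sym (lariat n)) (partition_of [int n + 1, 2]) = 4 * of_nat n"
proof -
  have "partition_of [int n + 1, 2] = add_mset 2 {#n + 1#}"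
    by (simp add: partition_of_def nat_add_distrib add_mset_commute)
  then show ?thesis
    using assms lariat_coeff_add_2[of "{#n + 1#}" n] path_coeff_single[of 2]
    by (simp add: partitions_def insert_Diff_if)
qed

text \<open>The part 1 has factor \<open>k - 1 = 0\<close>, so only \<open>k = n\<close> counts and
  leaves \<open>{#2, 1#}\<close>. For \<open>n = 0\<close> the partition shrinks to (2,1) with
  coefficient 0, where the linear formula would be negative.\<close>

lemma lariat_coeff_4:
  assumes "n \<noteq> 2"
  shows "e_coeff (chromatic_sym (lariat n)) (partition_of [int n, 2, 1]) = max 0 (2 * (of_nat n - 1))"
proof (cases "n = 0")
  case True
  then have "partition_of [int n, 2, 1] = add_mset 2 {#1#}"
    by (simp add: partition_of_def)
  then show ?thesis
    using True lariat_coeff_add_2[of "{#1#}" n] by (simp add: partitions_def insert_Diff_if)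
next
  case False
  then have "partition_of [int n, 2, 1] = add_mset 2 {#n, 1#}"
    by (simp add: partition_of_def add_mset_commute)
  then show ?thesis
    using assms False lariat_coeff_add_2[of "{#n, 1#}" n] path_coeff_2_1
    by (cases "n = 1") (simp_all add: partitions_def insert_Diff_if of_nat_diff max_def)
qed

text \<open>Only \<open>k = n - 1\<close> counts and leaves \<open>{#2, 2#}\<close>. For
  \<open>n \<le> 1\<close> the nonpositive entry is dropped, and the sum for (2,2) is empty.\<close>

lemma lariat_coeff_5:
  assumes "n \<noteq> 3"
  shows "e_coeff (chromatic_sym (lariat n)) (partition_of [int n - 1, 2, 2])
    = max 0 (4 * (of_nat n - 2))"
proof (cases "n \<le> 1")
  case True
  then have "partition_of [int n - 1, 2, 2] = add_mset 2 {#2#}"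
    by (simp add: partition_of_def)
  then show ?thesis
    using True lariat_coeff_add_2[of "{#2#}" n] by (simp add: partitions_def max_def)
next
  case False
  then obtain m where n: "n = m + 2" by (metis add.commute le_Suc_ex not_less_eq_eq numeral_2_eq_2 One_nat_def)
  then have "partition_of [int n - 1, 2, 2] = add_mset 2 {#m + 1, 2#}"
    by (simp add: partition_of_def nat_add_distrib add_mset_commute)
  then show ?thesis
    using assms n lariat_coeff_add_2[of "{#m + 1, 2#}" n] path_coeff_2_2
    by (simp add: partitions_def insert_Diff_if)
qed

text \<open>The excluded values of \<open>n\<close> are those for which the first entry of the
  partition equals 2. No part above 2 is then left, and the coefficient is 0 instead of the value of
  the formula.\<close>

theorem theorem4p1:
  fixes n :: nat
  shows "(\<forall>la \<in> partitions. e_coeff (chromatic_sym (lariat n)) la \<noteq> 0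
            \<longrightarrow> e_coeff (chromatic_sym (path_graph (n + 3))) la \<noteq> 0)
    \<and> (\<forall>la \<in> partitions. 2 \<notin># la
            \<longrightarrow> e_coeff (chromatic_sym (lariat n)) la
                = 2 * e_coeff (chromatic_sym (path_graph (n + 3))) la)
    \<and> (n \<noteq> 1 \<longrightarrow> e_coeff (chromatic_sym (lariat n)) (partition_of [int n + 1, 2])
            = 4 * of_nat n)
    \<and> (n \<noteq> 2 \<longrightarrow> e_coeff (chromatic_sym (lariat n)) (partition_of [int n, 2, 1])
            = max 0 (2 * (of_nat n - 1)))
    \<and> (n \<noteq> 3 \<longrightarrow> e_coeff (chromatic_sym (lariat n)) (partition_of [int n - 1, 2, 2])
            = max 0 (4 * (of_nat n - 2)))"
proof (intro conjI ballI impI)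
  fix la assume la: "la \<in> partitions" and nz: "e_coeff (chromatic_sym (lariat n)) la \<noteq> 0"
  show "e_coeff (chromatic_sym (path_graph (n + 3))) la \<noteq> 0"
  proof
    assume "e_coeff (chromatic_sym (path_graph (n + 3))) la = 0"
    then have 0: "path_coeff (n + 3) la = 0" by (simp add: path_coeff_def)
    \<comment> \<open>This coefficient lies between 0 and the path coefficient assumed to vanish, so
      the correction term disappears as well.\<close>
    have "path_coeff (n + 1) (la - {#2#}) = 0" if "2 \<in># la"
      using path_coeff_remove_le[OF la that, of "n + 3"] 0
        path_coeff_nonneg[OF partitions_diff[OF la]] by (simp add: order_antisym)
    then show False using nz lariat_coeff[OF la, of n] 0 by (simp split: if_splits)
  qed
next
  fix la assume "la \<in> partitions" "2 \<notin># la"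
  then show "e_coeff (chromatic_sym (lariat n)) la = 2 * e_coeff (chromatic_sym (path_graph (n + 3))) la"
    by (simp add: lariat_coeff path_coeff_def)
qed (rule lariat_coeff_3 lariat_coeff_4 lariat_coeff_5, assumption)+

end
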